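(* Let $s\ge 1$. Then $(\Sigma^{s},\oplus)$ is an abelian $(s-1)$i-signed-group (equivalently, a commutative $(s-1)$i-loop satisfying signed-associativity), with identity element ${}^{0}0$.
   Context: **Magnitudes.** $P$ is a non-empty set with two binary operations $+$ and $\cdot$ such that: $(P,+)$ is a commutative monoid with identity $0$; $(P\setminus\{0\},\cdot)$ is an abelian group (its identity is written $1$); and $\cdot$ distributes over $+$ on both sides. Moreover $(P,+,\le)$ is a totally ordered (with translation-invariant order) cancellative commutative monoid, such that whenever $a\ge b$ there is a unique $c\in P$ with $b+c=a$, denoted $a-b$. Finally, $P$ has no nonzero additive inverses: if $a,b\in P$ and $a+b=0$ then $a=b=0$. **Multisign set.** Fix an integer $s\ge 1$ and let $D=\{0,1,\dots,s\}$. The set $\Sigma^{s}$ consists of formal pairs ${}^{d}p$ with sign $d\in D$ and magnitude $p\in P$, where the sign $0$ is reserved for the element ${}^{0}0$, and ${}^{0}0$ is the only element with magnitude $0$. Thus $\Sigma^{s}=\{{}^{0}0\}\cup\{{}^{d}p: d\in\{1,\dots,s\},\ p\in P\setminus\{0\}\}$. **Addition.** For ${}^{i}a,{}^{j}b\in\Sigma^{s}$: $${}^{i}a\oplus{}^{j}b=\begin{cases}{}^{i}(a+b)&\text{if } i=j,\\ {}^{i}(a-b)&\text{if } i\ne j,\ a>b,\\ {}^{j}(b-a)&\text{if } i\neq j,\ a<b,\\ {}^{0}0&\text{if } i\ne j,\ a=b.\end{cases}$$ **Structures.** Let $\circledast$ be a binary operation on $\Sigma^s$ and $n\ge 0$ an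 integer. - $(\Sigma^s,\circledast)$ is an *$n$i-loop* if: (1) $\Sigma^s$ is closed under $\circledast$; (2) there is an identity ${}^{h}e\in \Sigma^s$ with ${}^{h}e\circledast x=x=x\circledast{}^{h}e$ for all $x\in \Sigma^s$; (3) for every $x\in \Sigma^s$ with $x\ne{}^{h}e$ there are exactly $n$ distinct $y\in \Sigma^s$ with $x\circledast y={}^{h}e=y\circledast x$, and the identity ${}^{h}e$ is its own unique inverse. - *Signed-associativity*: ${}^{i}a\circledast({}^{j}b\circledast{}^{k}c)=({}^{i}a\circledast{}^{j}b)\circledast{}^{k}c$ for all ${}^{i}a,{}^{j}b,{}^{k}c\in \Sigma^s$ whose signs satisfy $|\{i,j,k\}|\le 2$. - An *$n$i-signed-group* is an $n$i-loop satisfying signed-associativity; it is *abelian* if $\circledast$ is commutative. *)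

theory Defs
  imports "HOL-Algebra.Ring"
begin

record 'a ordered_semiring = "'a ring" +
  leq :: "'a \<Rightarrow> 'a \<Rightarrow> bool" (infix \<open>\<preceq>\<index>\<close> 50)

definition less_than_in :: "('a, 'b) ordered_semiring_scheme \<Rightarrow> 'a \<Rightarrow> 'a \<Rightarrow> bool"
    (infix \<open>\<prec>\<index>\<close> 50)
  where "a \<prec>\<^bsub>P\<^esub> b \<longleftrightarrow> a \<preceq>\<^bsub>P\<^esub> b \<and> a \<noteq> b"

text \<open>That zero is absorbing is not assumed; it follows from distributivity and cancellation.\<close>

locale magnitudes = abelian_monoid P for P :: "('a, 'b) ordered_semiring_scheme" (structure) +
  assumes mult_closed: "\<lbrakk>a \<in> carrier P; b \<in> carrier P\<rbrakk> \<Longrightarrow> a \<otimes> b \<in> carrier P"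
    and nonzero_comm_group: "comm_group (P\<lparr>carrier := carrier P - {\<zero>}\<rparr>)"
    and distrib_left:
      "\<lbrakk>a \<in> carrier P; b \<in> carrier P; c \<in> carrier P\<rbrakk> \<Longrightarrow> a \<otimes> (b \<oplus> c) = (a \<otimes> b) \<oplus> (a \<otimes> c)"
    and distrib_right:
      "\<lbrakk>a \<in> carrier P; b \<in> carrier P; c \<in> carrier P\<rbrakk> \<Longrightarrow> (a \<oplus> b) \<otimes> c = (a \<otimes> c) \<oplus> (b \<otimes> c)"
    and linear_order:
      "linear_order_on (carrier P) {(a, b). a \<in> carrier P \<and> b \<in> carrier P \<and> a \<preceq> b}"
    and translation_invariant:
      "\<lbrakk>a \<in> carrier P; b \<in> carrier P; c \<in> carrier P; a \<preceq> b\<rbrakk> \<Longrightarrow> a \<oplus> c \<preceq> b \<oplus> c"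
    and add_cancel:
      "\<lbrakk>a \<in> carrier P; b \<in> carrier P; c \<in> carrier P; a \<oplus> c = b \<oplus> c\<rbrakk> \<Longrightarrow> a = b"
    and ex1_difference:
      "\<lbrakk>a \<in> carrier P; b \<in> carrier P; b \<preceq> a\<rbrakk> \<Longrightarrow> \<exists>!c. c \<in> carrier P \<and> b \<oplus> c = a"
    and no_additive_inverses:
      "\<lbrakk>a \<in> carrier P; b \<in> carrier P; a \<oplus> b = \<zero>\<rbrakk> \<Longrightarrow> a = \<zero> \<and> b = \<zero>"

text \<open>Only meaningful for \<^term>\<open>b \<preceq>\<^bsub>P\<^esub> a\<close>.\<close>

definition mag_diff :: "('a, 'b) ordered_semiring_scheme \<Rightarrow> 'a \<Rightarrow> 'a \<Rightarrow> 'a"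
  where "mag_diff P a b = (THE c. c \<in> carrier P \<and> b \<oplus>\<^bsub>P\<^esub> c = a)"

text \<open>The pair \<open>(d, p)\<close> stands for the element with sign \<open>d\<close> and magnitude \<open>p\<close>.\<close>

definition multisign_set :: "('a, 'b) ordered_semiring_scheme \<Rightarrow> nat \<Rightarrow> (nat \<times> 'a) set"
  where "multisign_set P s =
    {(0, \<zero>\<^bsub>P\<^esub>)} \<union> {(d, p). d \<in> {1..s} \<and> p \<in> carrier P - {\<zero>\<^bsub>P\<^esub>}}"

text \<open>By totality of the order, the final case is that of different signs and equal magnitudes.\<close>

fun multisign_add ::
    "('a, 'b) ordered_semiring_scheme \<Rightarrow> nat \<times> 'a \<Rightarrow> nat \<times> 'a \<Rightarrow> nat \<times> 'a"
  where "multisign_add P (i, a) (j, b) =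
    (if i = j then (i, a \<oplus>\<^bsub>P\<^esub> b)
     else if b \<prec>\<^bsub>P\<^esub> a then (i, mag_diff P a b)
     else if a \<prec>\<^bsub>P\<^esub> b then (j, mag_diff P b a)
     else (0, \<zero>\<^bsub>P\<^esub>))"

definition is_identity :: "'c set \<Rightarrow> ('c \<Rightarrow> 'c \<Rightarrow> 'c) \<Rightarrow> 'c \<Rightarrow> bool"
  where "is_identity S f e \<longleftrightarrow> e \<in> S \<and> (\<forall>x\<in>S. f e x = x \<and> f x e = x)"

definition inverses :: "'c set \<Rightarrow> ('c \<Rightarrow> 'c \<Rightarrow> 'c) \<Rightarrow> 'c \<Rightarrow> 'c \<Rightarrow> 'c set"
  where "inverses S f e x = {y \<in> S. f x y = e \<and> f y x = e}"

text \<open>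
  The finiteness condition matters for \<open>n = 0\<close>, as infinite sets have cardinality \<open>0\<close>.
\<close>

definition ni_loop :: "nat \<Rightarrow> 'c set \<Rightarrow> ('c \<Rightarrow> 'c \<Rightarrow> 'c) \<Rightarrow> bool"
  where "ni_loop n S f \<longleftrightarrow>
    (\<forall>x\<in>S. \<forall>y\<in>S. f x y \<in> S) \<and>
    (\<exists>e. is_identity S f e \<and>
      (\<forall>x\<in>S. x \<noteq> e \<longrightarrow> finite (inverses S f e x) \<and> card (inverses S f e x) = n) \<and>
      inverses S f e e = {e})"

definition signed_associative ::
    "(nat \<times> 'a) set \<Rightarrow> (nat \<times> 'a \<Rightarrow> nat \<times> 'a \<Rightarrow> nat \<times> 'a) \<Rightarrow> bool"
  where "signed_associative S f \<longleftrightarrow>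
    (\<forall>x\<in>S. \<forall>y\<in>S. \<forall>z\<in>S. card {fst x, fst y, fst z} \<le> 2 \<longrightarrow> f x (f y z) = f (f x y) z)"

definition ni_signed_group ::
    "nat \<Rightarrow> (nat \<times> 'a) set \<Rightarrow> (nat \<times> 'a \<Rightarrow> nat \<times> 'a \<Rightarrow> nat \<times> 'a) \<Rightarrow> bool"
  where "ni_signed_group n S f \<longleftrightarrow> ni_loop n S f \<and> signed_associative S f"

definition abelian_ni_signed_group ::
    "nat \<Rightarrow> (nat \<times> 'a) set \<Rightarrow> (nat \<times> 'a \<Rightarrow> nat \<times> 'a \<Rightarrow> nat \<times> 'a) \<Rightarrow> bool"
  where "abelian_ni_signed_group n S f \<longleftrightarrow>
    ni_signed_group n S f \<and> (\<forall>x\<in>S. \<forall>y\<in>S. f x y = f y x)"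

end

theory Submission
  imports Defs
begin

text \<open>
  Associativity on elements whose signs lie in \<open>{0, i, j}\<close> is that of the group of differences of
  \<open>P\<close>: read sign \<open>i\<close> as positive and \<open>j\<close> as negative. Each such element then has a positive and
  a negative part, at most one of them nonzero, and it is determined by their formal difference,
  which is additive under \<open>\<oplus>\<close>. As subtraction is unavailable in \<open>P\<close>, an equation \<open>a - b = c - d\<close>
  is written \<open>a + d = c + b\<close>.
\<close>

context magnitudes
begin

section \<open>Order and subtraction of magnitudes\<close>

lemma order_refl: "a \<in> carrier P \<Longrightarrow> a \<preceq> a"
  using linear_order
  by (auto simp: linear_order_on_def partial_order_on_def preorder_on_def refl_on_def)

lemma order_antisym: "\<lbrakk>a \<in> carrier P; b \<in> carrier P; a \<preceq> b; b \<preceq> a\<rbrakk> \<Longrightarrow> a = b"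
  using linear_order
  by (auto simp: linear_order_on_def partial_order_on_def antisym_def)

lemma order_total: "\<lbrakk>a \<in> carrier P; b \<in> carrier P\<rbrakk> \<Longrightarrow> a \<preceq> b \<or> b \<preceq> a"
  using linear_order order_refl
  by (cases "a = b") (auto simp: linear_order_on_def total_on_def)

text \<open>Each case also carries the refuted comparisons, so that every branch of
  \<open>multisign_add\<close> can be decided by simplification.\<close>

lemma less_cases:
  assumes "a \<in> carrier P" "b \<in> carrier P"
  obtains (greater) "b \<prec> a" "\<not> a \<prec> b" "a \<noteq> b"
    | (less) "a \<prec> b" "\<not> b \<prec> a" "a \<noteq> b"
    | (equal) "a = b" "\<not> a \<prec> b" "\<not> b \<prec> a"
  using assms order_total order_antisym unfolding less_than_in_def by metis

text \<open>If \<open>a\<close> were below zero, the difference axiom would give \<open>c\<close>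
  with \<open>a + c = 0\<close>, and the absence of additive inverses would force
  \<open>a = 0\<close>.\<close>

lemma zero_less: "\<lbrakk>a \<in> carrier P; a \<noteq> \<zero>\<rbrakk> \<Longrightarrow> \<zero> \<prec> a"
  using order_total[of a \<zero>] ex1_difference[of \<zero> a] no_additive_inverses[of a]
  unfolding less_than_in_def by auto

lemma not_less_zero: "a \<in> carrier P \<Longrightarrow> \<not> a \<prec> \<zero>"
  using zero_less[of a] order_antisym[of a \<zero>] unfolding less_than_in_def by auto

lemma mag_diff_add:
  assumes "a \<in> carrier P" "b \<in> carrier P" "b \<prec> a"
  shows "mag_diff P a b \<in> carrier P" "b \<oplus> mag_diff P a b = a" "mag_diff P a b \<noteq> \<zero>"
proof -
  have *: "mag_diff P a b \<in> carrier P \<and> b \<oplus> mag_diff P a b = a"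
    unfolding mag_diff_def
    by (rule theI') (use ex1_difference assms in \<open>auto simp: less_than_in_def\<close>)
  then show "mag_diff P a b \<in> carrier P" "b \<oplus> mag_diff P a b = a"
    by auto
  show "mag_diff P a b \<noteq> \<zero>"
    using * assms by (auto simp: less_than_in_def)
qed

lemma mag_diff_zero:
  assumes "a \<in> carrier P" "a \<noteq> \<zero>"
  shows "mag_diff P a \<zero> = a"
  using mag_diff_add[OF assms(1) zero_closed zero_less[OF assms]] by simp

lemma add_nonzero: "\<lbrakk>a \<in> carrier P; b \<in> carrier P; a \<noteq> \<zero>\<rbrakk> \<Longrightarrow> a \<oplus> b \<noteq> \<zero>"
  using no_additive_inverses by blast

section \<open>The loop structure: closure, identity and the count of inverses\<close>

lemma multisign_setD:
  assumes "x \<in> multisign_set P s"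
  shows "snd x \<in> carrier P" "fst x = 0 \<longleftrightarrow> snd x = \<zero>"
  using assms by (auto simp: multisign_set_def)

text \<open>The point to check is that sign 0 never meets a nonzero magnitude: the element of sign 0
  has the least magnitude, so it never wins a strict comparison.\<close>

lemma multisign_add_closed:
  assumes "x \<in> multisign_set P s" "y \<in> multisign_set P s"
  shows "multisign_add P x y \<in> multisign_set P s"
proof -
  obtain i a j b where xy: "x = (i, a)" "y = (j, b)"
    by (cases x, cases y) auto
  have ab: "a \<in> carrier P" "b \<in> carrier P"
    using assms multisign_setD(1) xy by force+
  show ?thesis
    by (rule less_cases[OF ab])
      (use assms ab in
        \<open>auto simp: xy multisign_set_def mag_diff_add add_nonzero not_less_zero\<close>)
qed

lemma multisign_add_commute:
  assumes "x \<in> multisign_set P s" "y \<in> multisign_set P s"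
  shows "multisign_add P x y = multisign_add P y x"
proof -
  obtain i a j b where xy: "x = (i, a)" "y = (j, b)"
    by (cases x, cases y) auto
  have ab: "a \<in> carrier P" "b \<in> carrier P"
    using assms multisign_setD(1) xy by force+
  show ?thesis
    by (rule less_cases[OF ab]) (use ab in \<open>auto simp: xy a_comm\<close>)
qed

lemma multisign_identity: "is_identity (multisign_set P s) (multisign_add P) (0, \<zero>)"
proof -
  have "multisign_add P (0, \<zero>) x = x" if "x \<in> multisign_set P s" for x
    using that by (auto simp: multisign_set_def zero_less not_less_zero mag_diff_zero)
  then show ?thesis
    using multisign_add_commute[of _ s "(0, \<zero>)"]
    by (auto simp: is_identity_def multisign_set_def)
qed

text \<open>With \<open>i\<close> nonzero, \<open>a\<close> is nonzero too, so equal signs give a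
  nonzero sum. A strict comparison leaves a nonzero difference, so only the last branch of
  \<open>multisign_add\<close> yields zero.\<close>

lemma multisign_add_eq_zero_iff:
  assumes "(i, a) \<in> multisign_set P s" "(j, b) \<in> multisign_set P s" "i \<noteq> 0"
  shows "multisign_add P (i, a) (j, b) = (0, \<zero>) \<longleftrightarrow> i \<noteq> j \<and> a = b"
proof -
  have ab: "a \<in> carrier P" "b \<in> carrier P" "a \<noteq> \<zero>"
    using assms multisign_setD by force+
  show ?thesis
    by (rule less_cases[OF ab(1,2)]) (use assms(3) ab in \<open>auto simp: mag_diff_add add_nonzero\<close>)
qed

lemma inverses_zero:
  "inverses (multisign_set P s) (multisign_add P) (0, \<zero>) (0, \<zero>) = {(0, \<zero>)}"
  using multisign_identity[of s] by (auto simp: inverses_def is_identity_def)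

text \<open>An inverse has its magnitude forced to be \<open>a\<close>, while its sign is free among
  the nonzero signs other than \<open>i\<close>; hence the count \<open>s - 1\<close>.\<close>

lemma inverses_nonzero:
  assumes "(i, a) \<in> multisign_set P s" "i \<noteq> 0"
  shows "inverses (multisign_set P s) (multisign_add P) (0, \<zero>) (i, a)
    = ({1..s} - {i}) \<times> {a}"
proof -
  have "y \<in> inverses (multisign_set P s) (multisign_add P) (0, \<zero>) (i, a)
      \<longleftrightarrow> y \<in> multisign_set P s \<and> fst y \<noteq> i \<and> snd y = a" for y
    using assms multisign_add_eq_zero_iff[of i a s "fst y" "snd y"]
      multisign_add_commute[of "(i, a)" s y]
    by (auto simp: inverses_def)
  \<comment> \<open>The magnitude \<open>a\<close> is nonzero, which rules out sign 0.\<close>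
  moreover have "y \<in> multisign_set P s \<longleftrightarrow> fst y \<in> {1..s}" if "snd y = a" for y
    using assms that by (cases y) (auto simp: multisign_set_def)
  ultimately show ?thesis
    by (auto simp: set_eq_iff)
qed

lemma multisign_ni_loop: "ni_loop (s - 1) (multisign_set P s) (multisign_add P)"
proof -
  have "finite (inverses (multisign_set P s) (multisign_add P) (0, \<zero>) x)
      \<and> card (inverses (multisign_set P s) (multisign_add P) (0, \<zero>) x) = s - 1"
    if x: "x \<in> multisign_set P s" "x \<noteq> (0, \<zero>)" for x
  proof -
    obtain i a where ia: "x = (i, a)"
      by (cases x)
    have i: "i \<noteq> 0" "i \<in> {1..s}"
      using x by (auto simp: multisign_set_def ia)
    show ?thesis
      using i x(1) unfolding ia by (simp add: inverses_nonzero card_cartesian_product)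
  qed
  then show ?thesis
    unfolding ni_loop_def
    using multisign_add_closed multisign_identity inverses_zero by blast
qed

section \<open>Formal differences and signed-associativity\<close>

definition pos_part :: "nat \<Rightarrow> nat \<times> 'a \<Rightarrow> 'a"
  where "pos_part i x = (if fst x = i then snd x else \<zero>)"

text \<open>Every sign other than \<open>i\<close> counts as negative, so \<open>j\<close> need not
  be a parameter. The element of sign 0 has both parts zero.\<close>

definition neg_part :: "nat \<Rightarrow> nat \<times> 'a \<Rightarrow> 'a"
  where "neg_part i x = (if fst x = i then \<zero> else snd x)"

lemma parts_closed:
  assumes "x \<in> multisign_set P s"
  shows "pos_part i x \<in> carrier P" "neg_part i x \<in> carrier P"
  using multisign_setD(1)[OF assms] by (auto simp: pos_part_def neg_part_def)

lemma add_left_cancel: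
  assumes "c \<oplus> a = c \<oplus> b" "a \<in> carrier P" "b \<in> carrier P" "c \<in> carrier P"
  shows "a = b"
  using assms add_cancel[of a b c] by (simp add: a_comm)

text \<open>From \<open>a - b = c - d\<close> and \<open>c - d = e - f\<close> to
  \<open>a - b = e - f\<close>: add the two equations and cancel \<open>c + d\<close>.\<close>

lemma difference_eq_trans:
  assumes "a \<oplus> d = c \<oplus> b" "c \<oplus> f = e \<oplus> d"
    and carr: "a \<in> carrier P" "b \<in> carrier P" "c \<in> carrier P"
      "d \<in> carrier P" "e \<in> carrier P" "f \<in> carrier P"
  shows "a \<oplus> f = e \<oplus> b"
proof -
  have "(c \<oplus> d) \<oplus> (a \<oplus> f) = (a \<oplus> d) \<oplus> (c \<oplus> f)"
    using carr by (simp add: a_ac)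
  also have "\<dots> = (c \<oplus> d) \<oplus> (e \<oplus> b)"
    unfolding assms(1,2) using carr by (simp add: a_ac)
  finally show ?thesis
    by (rule add_left_cancel) (use carr in auto)
qed

text \<open>This adds \<open>u - v\<close> to both sides of \<open>a - b = c - d\<close>.\<close>

lemma difference_add_left:
  assumes "a \<oplus> d = c \<oplus> b"
    and carr: "a \<in> carrier P" "b \<in> carrier P" "c \<in> carrier P"
      "d \<in> carrier P" "u \<in> carrier P" "v \<in> carrier P"
  shows "(u \<oplus> a) \<oplus> (v \<oplus> d) = (u \<oplus> c) \<oplus> (v \<oplus> b)"
proof -
  have "(u \<oplus> a) \<oplus> (v \<oplus> d) = (u \<oplus> v) \<oplus> (a \<oplus> d)"
    using carr by (simp add: a_ac)
  also have "\<dots> = (u \<oplus> c) \<oplus> (v \<oplus> b)"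
    unfolding assms(1) using carr by (simp add: a_ac)
  finally show ?thesis .
qed

text \<open>If only one of \<open>x\<close>, \<open>y\<close> has sign \<open>i\<close>, the
  equation says that their magnitudes sum to zero, so both vanish. Otherwise the magnitudes agree,
  and so do the signs, since besides \<open>i\<close> only 0 and \<open>j\<close> are possible and 0
  marks zero magnitude.\<close>

lemma eq_if_same_difference:
  assumes "x \<in> multisign_set P s" "y \<in> multisign_set P s"
    and "fst x \<in> {0, i, j}" "fst y \<in> {0, i, j}"
    and "pos_part i x \<oplus> neg_part i y = pos_part i y \<oplus> neg_part i x"
  shows "x = y"
  using assms(3-5) multisign_setD[OF assms(1)] multisign_setD[OF assms(2)]
    no_additive_inverses[of "snd x" "snd y"] no_additive_inverses[of "snd y" "snd x"]
  by (cases x; cases y) (auto simp: pos_part_def neg_part_def split: if_splits)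

lemma multisign_add_sign:
  "\<lbrakk>fst x \<in> A; fst y \<in> A; 0 \<in> A\<rbrakk> \<Longrightarrow> fst (multisign_add P x y) \<in> A"
  by (cases x; cases y) auto

lemma multisign_add_difference:
  assumes "x \<in> multisign_set P s" "y \<in> multisign_set P s"
    and "fst x \<in> {0, i, j}" "fst y \<in> {0, i, j}"
  shows "pos_part i (multisign_add P x y) \<oplus> (neg_part i x \<oplus> neg_part i y)
    = (pos_part i x \<oplus> pos_part i y) \<oplus> neg_part i (multisign_add P x y)"
proof -
  \<comment> \<open>Once zero is set aside, two unequal signs are \<open>i\<close> and
    \<open>j\<close> in some order, so addition subtracts exactly when a positive part meets a
    negative one.\<close>
  consider "x = (0, \<zero>)" | "y = (0, \<zero>)" | "fst x \<noteq> 0" "fst y \<noteq> 0"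
    using multisign_setD[OF assms(1)] multisign_setD[OF assms(2)]
    by (cases x; cases y) auto
  then show ?thesis
  proof cases
    case 1
    then have "multisign_add P x y = y"
      using multisign_identity assms by (auto simp: is_identity_def)
    then show ?thesis
      using 1 multisign_setD(1)[OF assms(2)] by (auto simp: pos_part_def neg_part_def)
  next
    case 2
    then have "multisign_add P x y = x"
      using multisign_identity assms by (auto simp: is_identity_def)
    then show ?thesis
      using 2 multisign_setD(1)[OF assms(1)] by (auto simp: pos_part_def neg_part_def)
  next
    case 3
    obtain k a l b where xy: "x = (k, a)" "y = (l, b)"
      by (cases x, cases y) auto
    have kl: "k \<noteq> 0" "l \<noteq> 0" "k \<in> {i, j}" "l \<in> {i, j}"
      using 3 assms xy by auto
    have ab: "a \<in> carrier P" "b \<in> carrier P"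
      using assms multisign_setD(1) xy by force+
    show ?thesis
      by (rule less_cases[OF ab])
        (use kl ab in \<open>auto simp: xy pos_part_def neg_part_def mag_diff_add a_comm\<close>)
  qed
qed

lemma multisign_add_assoc:
  assumes S: "x \<in> multisign_set P s" "y \<in> multisign_set P s" "z \<in> multisign_set P s"
    and signs: "fst x \<in> {0, i, j}" "fst y \<in> {0, i, j}" "fst z \<in> {0, i, j}"
  shows "multisign_add P x (multisign_add P y z) = multisign_add P (multisign_add P x y) z"
proof -
  let ?f = "multisign_add P" and ?p = "pos_part i" and ?n = "neg_part i"
  let ?l = "?f x (?f y z)" and ?r = "?f (?f x y) z"
  have S': "?f y z \<in> multisign_set P s" "?f x y \<in> multisign_set P s"
    "?l \<in> multisign_set P s" "?r \<in> multisign_set P s"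
    using S by (simp_all add: multisign_add_closed)
  have signs': "fst (?f y z) \<in> {0, i, j}" "fst (?f x y) \<in> {0, i, j}"
    using signs by (simp_all only: multisign_add_sign insertI1)
  have signs'': "fst ?l \<in> {0, i, j}" "fst ?r \<in> {0, i, j}"
    using signs signs' by (simp_all only: multisign_add_sign insertI1)
  note [simp] = S[THEN parts_closed(1)] S[THEN parts_closed(2)]
    S'[THEN parts_closed(1)] S'[THEN parts_closed(2)]
  let ?pos = "?p x \<oplus> (?p y \<oplus> ?p z)" and ?neg = "?n x \<oplus> (?n y \<oplus> ?n z)"
  \<comment> \<open>Both bracketings are shown to have the formal difference
    \<open>?pos - ?neg\<close>.\<close>
  have l: "?p ?l \<oplus> ?neg = ?pos \<oplus> ?n ?l"
    by (rule difference_eq_trans[OF multisign_add_difference[OF S(1) S'(1) signs(1) signs'(1)]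
          difference_add_left[OF multisign_add_difference[OF S(2,3) signs(2,3)]]]) auto
  \<comment> \<open>\<open>difference_add_left\<close> adds in front, so the parts of
    \<open>z\<close> come first here and are moved back afterwards.\<close>
  have "(?p z \<oplus> ?p (?f x y)) \<oplus> (?n z \<oplus> (?n x \<oplus> ?n y))
      = (?p z \<oplus> (?p x \<oplus> ?p y)) \<oplus> (?n z \<oplus> ?n (?f x y))"
    by (rule difference_add_left[OF multisign_add_difference[OF S(1,2) signs(1,2)]]) auto
  then have "(?p (?f x y) \<oplus> ?p z) \<oplus> ?neg = ?pos \<oplus> (?n (?f x y) \<oplus> ?n z)"
    by (simp add: a_ac)
  then have r: "?p ?r \<oplus> ?neg = ?pos \<oplus> ?n ?r"
    by (rule difference_eq_trans[OF multisign_add_difference[OF S'(2) S(3) signs'(2) signs(3)]])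
      auto
  have "?p ?l \<oplus> ?n ?r = ?p ?r \<oplus> ?n ?l"
    by (rule difference_eq_trans[OF l r[symmetric]]) auto
  then show ?thesis
    by (rule eq_if_same_difference[OF S'(3,4) signs''])
qed

lemma multisign_signed_associative:
  "signed_associative (multisign_set P s) (multisign_add P)"
  unfolding signed_associative_def
proof (intro ballI impI)
  fix x y z
  assume S: "x \<in> multisign_set P s" "y \<in> multisign_set P s" "z \<in> multisign_set P s"
    and "card {fst x, fst y, fst z} \<le> 2"
  then have "fst x = fst y \<or> fst x = fst z \<or> fst y = fst z"
    by (auto simp: card_insert_if split: if_splits)
  \<comment> \<open>Two of the three signs coincide: take \<open>i\<close> as their common value and
    \<open>j\<close> as the third sign.\<close>
  then obtain i j where "fst x \<in> {0, i, j}" "fst y \<in> {0, i, j}" "fst z \<in> {0, i, j}"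
    by auto
  with S show "multisign_add P x (multisign_add P y z) = multisign_add P (multisign_add P x y) z"
    by (rule multisign_add_assoc)
qed

end

theorem theorem3p18:
  fixes P :: "('a, 'b) ordered_semiring_scheme" and s :: nat
  assumes "magnitudes P"
    and "s \<ge> 1"
  shows "abelian_ni_signed_group (s - 1) (multisign_set P s) (multisign_add P)
    \<and> is_identity (multisign_set P s) (multisign_add P) (0, \<zero>\<^bsub>P\<^esub>)"
proof -
  interpret magnitudes P by fact
  show ?thesis
    unfolding abelian_ni_signed_group_def ni_signed_group_def
    using multisign_ni_loop multisign_signed_associative multisign_add_commute multisign_identity
    by blast
qed

end
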